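(* For each metric space $(X,d)$, the $c$-Scott topology on $(X,d)$ is coarser than the generalized Scott topology on $(X,d)$ and is finer than the $d$-Scott topology on $(X,d)$ (coarser and finer being understood non-strictly).
   Context: A metric space is a pair $(X,d)$ with $d:X\times X\to[0,\infty]$ such that $d(x,x)=0$ and $d(x,z)\le d(x,y)+d(y,z)$ for all $x,y,z$ (no symmetry, separation or finiteness is required). For $x\in X$, $r>0$, put $B(x,r)=\{y\in X\mid d(x,y)<r\}$. A net $\{x_i\}_i$ (indexed by a directed set) in $(X,d)$ is forward Cauchy if $\inf_i\sup_{k\ge j\ge i}d(x_j,x_k)=0$. An element $x\in X$ is a Yoneda limit of a forward Cauchy net $\{x_i\}_i$ if $d(x,y)=\inf_i\sup_{j\ge i}d(x_j,y)$ for all $y\in X$. A weight of $(X,d)$ is a function $\phi:X\to[0,\infty]$ with $\phi(x)\le\phi(y)+d(x,y)$ for all $x,y$. A weight $\phi$ is a Scott weight if for every forward Cauchy net $\{x_i\}_i$ and every Yoneda limit $x$ of it, $\inf_i\sup_{j\ge i}\phi(x_j)\ge\phi(x)$. The Scott distance of $(X,d)$ is the approach distance $\sigma:X\times 2^X\to[0,\infty]$, $\sigma(x,A)=\sup\{\phi(x)\mid\phi\text{ is a Scott weight and }\phi(a)=0\text{ for all }a\in A\}$. The $c$-Scott topology on $(X,d)$ is the topological coreflection of $\sigma$, i.e. the topology on $X$ in which $x\in\overline{A}$ if and only if $\sigma(x,A)=0$; equivalently, the topology whose closed sets are exactly the sets $\phi^{-1}(0)$ with $\phi$ a Scott weight.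 A subset $U\subseteq X$ is generalized Scott open if for every forward Cauchy net $\{x_i\}_i$ and every Yoneda limit $x$ of it, $x\in U$ implies that there are $\varepsilon>0$ and an index $i$ such that $B(x_j,\varepsilon)\subseteq U$ for all $j\ge i$. These sets form the generalized Scott topology. Let $\mathrm{B}X=\{(x,r)\mid x\in X,\ r\in[0,\infty)\}$ with the reflexive transitive relation $(x,r)\sqsubseteq(y,s)\iff r\ge s+d(x,y)$. A subset of a (pre)ordered set is Scott closed if it is a lower set and closed under (existing) joins of directed subsets; Scott closed sets are the closed sets of the Scott topology. The $d$-Scott topology on $(X,d)$ is the topology on $X$ inherited from the Scott topology on $(\mathrm{B}X,\sqsubseteq)$ via the embedding $\eta_X:X\to\mathrm{B}X$, $x\mapsto(x,0)$. *)

theory Defs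
  imports "HOL-Analysis.Analysis"
begin

section \<open>Metric spaces in the sense of Lawvere\<close>

text \<open>The carrier is a set \<open>X\<close>; values of \<open>d\<close> (and of weights) outside \<open>X\<close> are irrelevant.\<close>

definition lawvere_metric :: "'a set \<Rightarrow> ('a \<Rightarrow> 'a \<Rightarrow> ennreal) \<Rightarrow> bool" where
  "lawvere_metric X d \<longleftrightarrow>
     (\<forall>x\<in>X. d x x = 0) \<and> (\<forall>x\<in>X. \<forall>y\<in>X. \<forall>z\<in>X. d x z \<le> d x y + d y z)"

definition metric_ball :: "'a set \<Rightarrow> ('a \<Rightarrow> 'a \<Rightarrow> ennreal) \<Rightarrow> 'a \<Rightarrow> real \<Rightarrow> 'a set" where
  "metric_ball X d x r = {y \<in> X. d x y < ennreal r}"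

section \<open>Nets\<close>

text \<open>Directed sets are nonempty and preordered; antisymmetry is not required.\<close>

definition directed_on :: "'i set \<Rightarrow> ('i \<Rightarrow> 'i \<Rightarrow> bool) \<Rightarrow> bool" where
  "directed_on I le \<longleftrightarrow>
     I \<noteq> {} \<and> reflp_on I le \<and> transp_on I le \<and> (\<forall>i\<in>I. \<forall>j\<in>I. \<exists>k\<in>I. le i k \<and> le j k)"

definition net_limsup :: "'i set \<Rightarrow> ('i \<Rightarrow> 'i \<Rightarrow> bool) \<Rightarrow> ('i \<Rightarrow> ennreal) \<Rightarrow> ennreal" where
  "net_limsup I le f = (INF i\<in>I. SUP j\<in>{j\<in>I. le i j}. f j)"

definition forward_cauchy_net ::
  "'a set \<Rightarrow> ('a \<Rightarrow> 'a \<Rightarrow> ennreal) \<Rightarrow> 'i set \<Rightarrow> ('i \<Rightarrow> 'i \<Rightarrow> bool) \<Rightarrow> ('i \<Rightarrow> 'a) \<Rightarrow> bool" where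
  "forward_cauchy_net X d I le x \<longleftrightarrow>
     directed_on I le \<and> x ` I \<subseteq> X \<and>
     (INF i\<in>I. SUP j\<in>{j\<in>I. le i j}. SUP k\<in>{k\<in>I. le j k}. d (x j) (x k)) = 0"

definition yoneda_limit ::
  "'a set \<Rightarrow> ('a \<Rightarrow> 'a \<Rightarrow> ennreal) \<Rightarrow> 'i set \<Rightarrow> ('i \<Rightarrow> 'i \<Rightarrow> bool) \<Rightarrow> ('i \<Rightarrow> 'a) \<Rightarrow> 'a \<Rightarrow> bool" where
  "yoneda_limit X d I le x p \<longleftrightarrow> p \<in> X \<and> (\<forall>y\<in>X. d p y = net_limsup I le (\<lambda>j. d (x j) y))"

section \<open>Weights, Scott weights and the Scott distance\<close>

definition weight_on :: "'a set \<Rightarrow> ('a \<Rightarrow> 'a \<Rightarrow> ennreal) \<Rightarrow> ('a \<Rightarrow> ennreal) \<Rightarrow> bool" where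
  "weight_on X d \<phi> \<longleftrightarrow> (\<forall>x\<in>X. \<forall>y\<in>X. \<phi> x \<le> \<phi> y + d x y)"

text \<open>
  A definition in HOL cannot quantify over the types of index sets, so here and in
  \<open>generalized_scott_open\<close> the nets are indexed by arbitrary directed sets of elements
  of type \<open>'a \<times> real\<close>. Nothing is lost: by the lemmas \<open>scott_weight_net\<close> and
  \<open>generalized_scott_open_net\<close> below, both conditions then hold for nets indexed by
  directed sets over any type.
\<close>

definition scott_weight :: "'a set \<Rightarrow> ('a \<Rightarrow> 'a \<Rightarrow> ennreal) \<Rightarrow> ('a \<Rightarrow> ennreal) \<Rightarrow> bool" where
  "scott_weight X d \<phi> \<longleftrightarrow>
     weight_on X d \<phi> \<and>
     (\<forall>(I :: ('a \<times> real) set) le x p.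
        forward_cauchy_net X d I le x \<longrightarrow> yoneda_limit X d I le x p \<longrightarrow>
        net_limsup I le (\<lambda>j. \<phi> (x j)) \<ge> \<phi> p)"

definition scott_distance :: "'a set \<Rightarrow> ('a \<Rightarrow> 'a \<Rightarrow> ennreal) \<Rightarrow> 'a \<Rightarrow> 'a set \<Rightarrow> ennreal" where
  "scott_distance X d x A = (SUP \<phi>\<in>{\<phi>. scott_weight X d \<phi> \<and> (\<forall>a\<in>A. \<phi> a = 0)}. \<phi> x)"

section \<open>The three topologies\<close>

text \<open>A set is open if no point of it has Scott distance \<open>0\<close> from its complement; see
  \<open>closure_of_c_scott\<close> for the description of the closure operator.\<close>

definition c_scott_topology :: "'a set \<Rightarrow> ('a \<Rightarrow> 'a \<Rightarrow> ennreal) \<Rightarrow> 'a topology" where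
  "c_scott_topology X d =
     topology (\<lambda>U. U \<subseteq> X \<and> (\<forall>x\<in>X. scott_distance X d x (X - U) = 0 \<longrightarrow> x \<in> X - U))"

definition generalized_scott_open :: "'a set \<Rightarrow> ('a \<Rightarrow> 'a \<Rightarrow> ennreal) \<Rightarrow> 'a set \<Rightarrow> bool" where
  "generalized_scott_open X d U \<longleftrightarrow>
     U \<subseteq> X \<and>
     (\<forall>(I :: ('a \<times> real) set) le x p.
        forward_cauchy_net X d I le x \<longrightarrow> yoneda_limit X d I le x p \<longrightarrow> p \<in> U \<longrightarrow>
        (\<exists>\<epsilon>>0. \<exists>i\<in>I. \<forall>j\<in>I. le i j \<longrightarrow> metric_ball X d (x j) \<epsilon> \<subseteq> U))"

definition generalized_scott_topology :: "'a set \<Rightarrow> ('a \<Rightarrow> 'a \<Rightarrow> ennreal) \<Rightarrow> 'a topology" where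
  "generalized_scott_topology X d = topology (generalized_scott_open X d)"

definition formal_balls :: "'a set \<Rightarrow> ('a \<times> real) set" where
  "formal_balls X = X \<times> {0..}"

definition ball_le :: "('a \<Rightarrow> 'a \<Rightarrow> ennreal) \<Rightarrow> 'a \<times> real \<Rightarrow> 'a \<times> real \<Rightarrow> bool" where
  "ball_le d p q \<longleftrightarrow> ennreal (snd p) \<ge> ennreal (snd q) + d (fst p) (fst q)"

text \<open>In a preorder, joins are determined only up to equivalence; a Scott closed set has to
  contain every join of a directed subset.\<close>

definition is_join :: "'b set \<Rightarrow> ('b \<Rightarrow> 'b \<Rightarrow> bool) \<Rightarrow> 'b set \<Rightarrow> 'b \<Rightarrow> bool" where
  "is_join P le D z \<longleftrightarrow>
     z \<in> P \<and> (\<forall>a\<in>D. le a z) \<and> (\<forall>u\<in>P. (\<forall>a\<in>D. le a u) \<longrightarrow> le z u)"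

definition scott_closed :: "'b set \<Rightarrow> ('b \<Rightarrow> 'b \<Rightarrow> bool) \<Rightarrow> 'b set \<Rightarrow> bool" where
  "scott_closed P le C \<longleftrightarrow>
     C \<subseteq> P \<and>
     (\<forall>a\<in>P. \<forall>b\<in>C. le a b \<longrightarrow> a \<in> C) \<and>
     (\<forall>D z. D \<subseteq> C \<longrightarrow> directed_on D le \<longrightarrow> is_join P le D z \<longrightarrow> z \<in> C)"

definition scott_topology :: "'b set \<Rightarrow> ('b \<Rightarrow> 'b \<Rightarrow> bool) \<Rightarrow> 'b topology" where
  "scott_topology P le = topology (\<lambda>U. U \<subseteq> P \<and> scott_closed P le (P - U))"

definition d_scott_topology :: "'a set \<Rightarrow> ('a \<Rightarrow> 'a \<Rightarrow> ennreal) \<Rightarrow> 'a topology" where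
  "d_scott_topology X d =
     pullback_topology X (\<lambda>x. (x, 0)) (scott_topology (formal_balls X) (ball_le d))"

section \<open>Independence of the type of indices\<close>

lemma forward_cauchy_tail:
  assumes "forward_cauchy_net X d I le x" and "(e::real) > 0"
  shows "\<exists>i\<in>I. \<forall>j\<in>I. le i j \<longrightarrow> (\<forall>k\<in>I. le j k \<longrightarrow> d (x j) (x k) \<le> ennreal e)"
proof -
  have "(INF i\<in>I. SUP j\<in>{j\<in>I. le i j}. SUP k\<in>{k\<in>I. le j k}. d (x j) (x k)) < ennreal e"
    using assms by (simp add: forward_cauchy_net_def)
  then obtain i where i: "i \<in> I"
    "(SUP j\<in>{j\<in>I. le i j}. SUP k\<in>{k\<in>I. le j k}. d (x j) (x k)) < ennreal e"
    by (auto simp: INF_less_iff)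
  have "d (x j) (x k) \<le> ennreal e" if "j \<in> I" "le i j" "k \<in> I" "le j k" for j k
  proof -
    have "d (x j) (x k) \<le> (SUP k\<in>{k\<in>I. le j k}. d (x j) (x k))"
      using that by (intro SUP_upper) auto
    also have "\<dots> \<le> (SUP j\<in>{j\<in>I. le i j}. SUP k\<in>{k\<in>I. le j k}. d (x j) (x k))"
      using that by (intro SUP_upper) auto
    finally show ?thesis using i(2) by simp
  qed
  with i(1) show ?thesis by blast
qed

lemma forward_cauchy_netI:
  assumes "directed_on I le" "x ` I \<subseteq> X"
    and "\<And>e::real. e > 0 \<Longrightarrow>
      \<exists>i\<in>I. \<forall>j\<in>I. le i j \<longrightarrow> (\<forall>k\<in>I. le j k \<longrightarrow> d (x j) (x k) \<le> ennreal e)"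
  shows "forward_cauchy_net X d I le x"
proof -
  have "(INF i\<in>I. SUP j\<in>{j\<in>I. le i j}. SUP k\<in>{k\<in>I. le j k}. d (x j) (x k)) \<le> 0 + ennreal e"
    if e: "e > 0" for e :: real
  proof -
    obtain i where "i \<in> I"
      "\<forall>j\<in>I. le i j \<longrightarrow> (\<forall>k\<in>I. le j k \<longrightarrow> d (x j) (x k) \<le> ennreal e)"
      using assms(3)[OF e] by blast
    then show ?thesis by (intro INF_lower2[of i]) (auto intro!: SUP_least)
  qed
  then have "(INF i\<in>I. SUP j\<in>{j\<in>I. le i j}. SUP k\<in>{k\<in>I. le j k}. d (x j) (x k)) \<le> 0"
    by (rule ennreal_le_epsilon)
  with assms(1,2) show ?thesis by (simp add: forward_cauchy_net_def)
qed

lemma directed_onD: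
  assumes "directed_on I le"
  shows "I \<noteq> {}" "i \<in> I \<Longrightarrow> le i i"
    "i \<in> I \<Longrightarrow> j \<in> I \<Longrightarrow> k \<in> I \<Longrightarrow> le i j \<Longrightarrow> le j k \<Longrightarrow> le i k"
    "i \<in> I \<Longrightarrow> j \<in> I \<Longrightarrow> \<exists>k\<in>I. le i k \<and> le j k"
  using assms unfolding directed_on_def by (auto dest: reflp_onD transp_onD)

text \<open>A forward Cauchy net is replaced by one indexed by formal balls.\<close>

definition ball_index ::
  "('a \<Rightarrow> 'a \<Rightarrow> ennreal) \<Rightarrow> 'i set \<Rightarrow> ('i \<Rightarrow> 'i \<Rightarrow> bool) \<Rightarrow> ('i \<Rightarrow> 'a) \<Rightarrow> ('a \<times> real) set" where
  "ball_index d I le x =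
     {(a, r). \<exists>j\<in>I. a = x j \<and>
        (\<exists>s\<ge>0. s < r \<and> (\<forall>k\<in>I. le j k \<longrightarrow> d (x j) (x k) \<le> ennreal s))}"

lemma ball_indexI:
  assumes "j \<in> I" "0 \<le> s" "s < r" "\<And>k. k \<in> I \<Longrightarrow> le j k \<Longrightarrow> d (x j) (x k) \<le> ennreal s"
  shows "(x j, r) \<in> ball_index d I le x"
  using assms unfolding ball_index_def by blast

lemma ball_indexE:
  assumes "p \<in> ball_index d I le x"
  obtains j r s where "p = (x j, r)" "j \<in> I" "0 \<le> s" "s < r"
    "\<And>k. k \<in> I \<Longrightarrow> le j k \<Longrightarrow> d (x j) (x k) \<le> ennreal s"
  using assms unfolding ball_index_def by blast

lemma ball_index_cofinal:
  assumes fc: "forward_cauchy_net X d I le x" and p: "p \<in> ball_index d I le x"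
  shows "\<exists>i\<in>I. \<exists>T>0. \<forall>l\<in>I. le i l \<longrightarrow>
    (\<forall>t. 0 < t \<and> t \<le> T \<longrightarrow> ball_le d p (x l, t)) \<and> (x l, T) \<in> ball_index d I le x"
proof -
  have dir: "directed_on I le" using fc by (simp add: forward_cauchy_net_def)
  obtain j r s where j: "p = (x j, r)" "j \<in> I" "0 \<le> s" "s < r"
    "\<And>k. k \<in> I \<Longrightarrow> le j k \<Longrightarrow> d (x j) (x k) \<le> ennreal s"
    using ball_indexE[OF p] by metis
  define T where "T = r - s"
  have T: "T > 0" using j by (simp add: T_def)
  then obtain i0 where i0: "i0 \<in> I"
    "\<forall>j\<in>I. le i0 j \<longrightarrow> (\<forall>k\<in>I. le j k \<longrightarrow> d (x j) (x k) \<le> ennreal (T/2))"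
    using forward_cauchy_tail[OF fc, of "T/2"] by auto
  obtain i where i: "i \<in> I" "le i0 i" "le j i" using directed_onD(4)[OF dir i0(1) j(2)] by blast
  have "(\<forall>t. 0 < t \<and> t \<le> T \<longrightarrow> ball_le d p (x l, t)) \<and> (x l, T) \<in> ball_index d I le x"
    if l: "l \<in> I" "le i l" for l
  proof -
    have il: "le i0 l" "le j l" using directed_onD(3)[OF dir] i i0 j l by blast+
    have "ball_le d p (x l, t)" if t: "0 < t" "t \<le> T" for t
    proof -
      have "ennreal t + d (x j) (x l) \<le> ennreal t + ennreal s"
        using j(5)[OF l(1) il(2)] by (intro add_left_mono)
      also have "\<dots> = ennreal (t + s)" using t j(3) by (simp add: ennreal_plus)
      also have "\<dots> \<le> ennreal r" using t by (intro ennreal_leI) (simp add: T_def)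
      finally show ?thesis by (simp add: ball_le_def j(1))
    qed
    moreover have "(x l, T) \<in> ball_index d I le x"
      using T i0 il l by (intro ball_indexI[of _ _ "T/2"]) auto
    ultimately show ?thesis by blast
  qed
  with i(1) T show ?thesis by blast
qed

lemma ball_index_small:
  assumes fc: "forward_cauchy_net X d I le x" and e: "(e::real) > 0" and i: "i \<in> I"
  shows "\<exists>l\<in>I. le i l \<and> (\<forall>k\<in>I. le l k \<longrightarrow> (x k, e) \<in> ball_index d I le x)"
proof -
  have dir: "directed_on I le" using fc by (simp add: forward_cauchy_net_def)
  obtain i0 where i0: "i0 \<in> I"
    "\<forall>j\<in>I. le i0 j \<longrightarrow> (\<forall>k\<in>I. le j k \<longrightarrow> d (x j) (x k) \<le> ennreal (e/2))"
    using forward_cauchy_tail[OF fc, of "e/2"] e by auto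
  obtain l where l: "l \<in> I" "le i0 l" "le i l" using directed_onD(4)[OF dir i0(1) i] by blast
  have "(x k, e) \<in> ball_index d I le x" if k: "k \<in> I" "le l k" for k
  proof -
    have "le i0 k" using directed_onD(3)[OF dir] i0(1) l k by blast
    with i0(2) k e show ?thesis by (intro ball_indexI[of _ _ "e/2"]) auto
  qed
  with l show ?thesis by blast
qed

lemma ball_index_le_radius: "ball_le d p q \<Longrightarrow> snd p > 0 \<Longrightarrow> snd q \<le> snd p"
proof -
  assume p: "ball_le d p q" "snd p > 0"
  have "ennreal (snd q) \<le> ennreal (snd q) + d (fst p) (fst q)" by simp
  also have "\<dots> \<le> ennreal (snd p)" using p(1) by (simp add: ball_le_def)
  finally show ?thesis using p(2) by (simp add: ennreal_le_iff)
qed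

lemma ball_le_dist: "ball_le d p q \<Longrightarrow> d (fst p) (fst q) \<le> ennreal (snd p)"
proof -
  assume p: "ball_le d p q"
  have "d (fst p) (fst q) \<le> ennreal (snd q) + d (fst p) (fst q)" by simp
  also have "\<dots> \<le> ennreal (snd p)" using p by (simp add: ball_le_def)
  finally show ?thesis .
qed

lemma forward_cauchy_ball_index:
  assumes m: "lawvere_metric X d" and fc: "forward_cauchy_net X d I le x"
  shows "forward_cauchy_net X d (ball_index d I le x) (ball_le d) fst"
proof (rule forward_cauchy_netI)
  let ?J = "ball_index d I le x"
  have dir: "directed_on I le" and xX: "x ` I \<subseteq> X" using fc by (auto simp: forward_cauchy_net_def)
  obtain i1 where i1: "i1 \<in> I" using directed_onD(1)[OF dir] by blast
  have inX: "fst p \<in> X" if "p \<in> ?J" for p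
    using that xX by (auto simp: ball_index_def)
  show "fst ` ?J \<subseteq> X" using inX by blast
  show "directed_on ?J (ball_le d)"
    unfolding directed_on_def
  proof (intro conjI ballI)
    show "?J \<noteq> {}"
      using ball_index_small[OF fc zero_less_one i1] directed_onD(2)[OF dir] by blast
    show "reflp_on ?J (ball_le d)"
      using m inX by (intro reflp_onI) (auto simp: ball_le_def lawvere_metric_def)
    show "transp_on ?J (ball_le d)"
    proof (rule transp_onI)
      fix p q r assume pqr: "p \<in> ?J" "q \<in> ?J" "r \<in> ?J" "ball_le d p q" "ball_le d q r"
      have "d (fst p) (fst r) \<le> d (fst p) (fst q) + d (fst q) (fst r)"
        using m inX[OF pqr(1)] inX[OF pqr(2)] inX[OF pqr(3)] unfolding lawvere_metric_def by blast
      then have "ennreal (snd r) + d (fst p) (fst r)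
          \<le> ennreal (snd r) + (d (fst p) (fst q) + d (fst q) (fst r))"
        by (intro add_left_mono)
      also have "\<dots> = (ennreal (snd r) + d (fst q) (fst r)) + d (fst p) (fst q)"
        by (simp add: ac_simps)
      also have "\<dots> \<le> ennreal (snd q) + d (fst p) (fst q)"
        using pqr(5) by (intro add_right_mono) (simp add: ball_le_def)
      also have "\<dots> \<le> ennreal (snd p)" using pqr(4) by (simp add: ball_le_def)
      finally show "ball_le d p r" by (simp add: ball_le_def)
    qed
    fix p q assume pq: "p \<in> ?J" "q \<in> ?J"
    obtain i S where i: "i \<in> I" "S > 0" "\<forall>l\<in>I. le i l \<longrightarrow>
      (\<forall>t. 0 < t \<and> t \<le> S \<longrightarrow> ball_le d p (x l, t)) \<and> (x l, S) \<in> ?J"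
      using ball_index_cofinal[OF fc pq(1)] by blast
    obtain j T where j: "j \<in> I" "T > 0" "\<forall>l\<in>I. le j l \<longrightarrow>
      (\<forall>t. 0 < t \<and> t \<le> T \<longrightarrow> ball_le d q (x l, t)) \<and> (x l, T) \<in> ?J"
      using ball_index_cofinal[OF fc pq(2)] by blast
    obtain k where k: "k \<in> I" "le i k" "le j k" using directed_onD(4)[OF dir i(1) j(1)] by blast
    have ST: "min S T > 0" using i j by simp
    obtain l where l: "l \<in> I" "le k l" "\<forall>m\<in>I. le l m \<longrightarrow> (x m, min S T) \<in> ?J"
      using ball_index_small[OF fc ST k(1)] by blast
    have "le i l" "le j l" "le l l" using directed_onD(2,3)[OF dir] i j k l by blast+
    then have "ball_le d p (x l, min S T)" "ball_le d q (x l, min S T)" "(x l, min S T) \<in> ?J"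
      using i j l ST by simp_all
    then show "\<exists>k\<in>?J. ball_le d p k \<and> ball_le d q k" by blast
  qed
  fix e :: real assume e: "e > 0"
  obtain l where l: "l \<in> I" "(x l, e) \<in> ?J"
    using ball_index_small[OF fc e i1] directed_onD(2)[OF dir] by blast
  have "d (fst p) (fst q) \<le> ennreal e"
    if "p \<in> ?J" "ball_le d (x l, e) p" "q \<in> ?J" "ball_le d p q" for p q
  proof -
    have "snd p \<le> e" using ball_index_le_radius[OF that(2)] e by simp
    then have "ennreal (snd p) \<le> ennreal e" by (rule ennreal_leI)
    with ball_le_dist[OF that(4)] show ?thesis by order
  qed
  with l show "\<exists>i\<in>?J. \<forall>j\<in>?J. ball_le d i j \<longrightarrow>
      (\<forall>k\<in>?J. ball_le d j k \<longrightarrow> d (fst j) (fst k) \<le> ennreal e)"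
    by (intro bexI[of _ "(x l, e)"]) simp_all
qed

lemma net_limsup_ball_index:
  assumes fc: "forward_cauchy_net X d I le x" and w: "weight_on X d \<phi>"
  shows "net_limsup (ball_index d I le x) (ball_le d) (\<lambda>p. \<phi> (fst p)) = net_limsup I le (\<lambda>j. \<phi> (x j))"
    (is "?L = ?R")
proof (rule antisym)
  let ?J = "ball_index d I le x"
  have dir: "directed_on I le" and xX: "x ` I \<subseteq> X" using fc by (auto simp: forward_cauchy_net_def)
  show "?L \<le> ?R"
    unfolding net_limsup_def[of I]
  proof (rule INF_greatest)
    fix i assume i: "i \<in> I"
    let ?c = "SUP j\<in>{j\<in>I. le i j}. \<phi> (x j)"
    show "?L \<le> ?c"
    proof (rule ennreal_le_epsilon)
      fix e :: real assume e: "e > 0"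
      obtain l where l: "l \<in> I" "(x l, e) \<in> ?J"
        using ball_index_small[OF fc e i] directed_onD(2)[OF dir] by blast
      have "\<phi> (fst p) \<le> ?c + ennreal e" if p: "p \<in> ?J" "ball_le d (x l, e) p" for p
      proof -
        obtain j r s where j: "p = (x j, r)" "j \<in> I" "0 \<le> s" "s < r"
          "\<And>k. k \<in> I \<Longrightarrow> le j k \<Longrightarrow> d (x j) (x k) \<le> ennreal s"
          using ball_indexE[OF p(1)] by metis
        have "r \<le> e" using ball_index_le_radius[OF p(2)] e j(1) by simp
        then have se: "ennreal s \<le> ennreal e" using j by (intro ennreal_leI) simp
        obtain k where k: "k \<in> I" "le i k" "le j k" using directed_onD(4)[OF dir i j(2)] by blast
        have "\<phi> (x j) \<le> \<phi> (x k) + d (x j) (x k)"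
          using w xX j(2) k(1) by (auto simp: weight_on_def)
        also have "\<dots> \<le> ?c + ennreal e"
          using k j(5)[OF k(1,3)] se by (intro add_mono SUP_upper) auto
        finally show ?thesis by (simp add: j(1))
      qed
      then have "(SUP p\<in>{p\<in>?J. ball_le d (x l, e) p}. \<phi> (fst p)) \<le> ?c + ennreal e"
        by (auto intro!: SUP_least)
      then show "?L \<le> ?c + ennreal e"
        unfolding net_limsup_def by (rule INF_lower2[OF l(2)])
    qed
  qed
  show "?R \<le> ?L"
    unfolding net_limsup_def[of ?J]
  proof (rule INF_greatest)
    fix p assume p: "p \<in> ?J"
    obtain i T where i: "i \<in> I" "T > 0" "\<forall>l\<in>I. le i l \<longrightarrow>
      (\<forall>t. 0 < t \<and> t \<le> T \<longrightarrow> ball_le d p (x l, t)) \<and> (x l, T) \<in> ?J"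
      using ball_index_cofinal[OF fc p] by blast
    have "(SUP j\<in>{j\<in>I. le i j}. \<phi> (x j)) \<le> (SUP q\<in>{q\<in>?J. ball_le d p q}. \<phi> (fst q))"
    proof (rule SUP_least)
      fix l assume "l \<in> {j\<in>I. le i j}"
      with i show "\<phi> (x l) \<le> (SUP q\<in>{q\<in>?J. ball_le d p q}. \<phi> (fst q))"
        by (intro SUP_upper2[of "(x l, T)"]) auto
    qed
    then show "?R \<le> (SUP q\<in>{q\<in>?J. ball_le d p q}. \<phi> (fst q))"
      unfolding net_limsup_def by (rule INF_lower2[OF i(1)])
  qed
qed

lemma yoneda_limit_ball_index:
  assumes m: "lawvere_metric X d" and fc: "forward_cauchy_net X d I le x"
  shows "yoneda_limit X d (ball_index d I le x) (ball_le d) fst p \<longleftrightarrow> yoneda_limit X d I le x p"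
proof -
  have "weight_on X d (\<lambda>a. d a y)" if "y \<in> X" for y
    using m that by (auto simp: weight_on_def lawvere_metric_def add.commute)
  from net_limsup_ball_index[OF fc this] show ?thesis
    by (auto simp: yoneda_limit_def)
qed

lemma scott_weight_net:
  fixes I :: "'i set"
  assumes "lawvere_metric X d" "scott_weight X d \<phi>"
    and "forward_cauchy_net X d I le x" "yoneda_limit X d I le x p"
  shows "net_limsup I le (\<lambda>j. \<phi> (x j)) \<ge> \<phi> p"
proof -
  have "net_limsup (ball_index d I le x) (ball_le d) (\<lambda>q. \<phi> (fst q)) \<ge> \<phi> p"
    using assms forward_cauchy_ball_index[OF assms(1,3)] yoneda_limit_ball_index[OF assms(1,3)]
    unfolding scott_weight_def by blast
  moreover have "weight_on X d \<phi>" using assms(2) by (simp add: scott_weight_def)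
  ultimately show ?thesis using net_limsup_ball_index[OF assms(3), of \<phi>] by simp
qed

lemma generalized_scott_open_net:
  fixes I :: "'i set"
  assumes "lawvere_metric X d" "generalized_scott_open X d U"
    and "forward_cauchy_net X d I le x" "yoneda_limit X d I le x p" "p \<in> U"
  shows "\<exists>\<epsilon>>0. \<exists>i\<in>I. \<forall>j\<in>I. le i j \<longrightarrow> metric_ball X d (x j) \<epsilon> \<subseteq> U"
proof -
  let ?J = "ball_index d I le x"
  have "\<exists>\<epsilon>>0. \<exists>q\<in>?J. \<forall>r\<in>?J. ball_le d q r \<longrightarrow> metric_ball X d (fst r) \<epsilon> \<subseteq> U"
    using assms forward_cauchy_ball_index[OF assms(1,3)] yoneda_limit_ball_index[OF assms(1,3)]
    unfolding generalized_scott_open_def by blast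
  then obtain \<epsilon> q where q: "\<epsilon> > 0" "q \<in> ?J"
    "\<forall>r\<in>?J. ball_le d q r \<longrightarrow> metric_ball X d (fst r) \<epsilon> \<subseteq> U" by blast
  obtain i T where i: "i \<in> I" "T > 0" "\<forall>l\<in>I. le i l \<longrightarrow>
      (\<forall>t. 0 < t \<and> t \<le> T \<longrightarrow> ball_le d q (x l, t)) \<and> (x l, T) \<in> ?J"
    using ball_index_cofinal[OF assms(3) q(2)] by blast
  have "metric_ball X d (x j) \<epsilon> \<subseteq> U" if j: "j \<in> I" "le i j" for j
  proof -
    have "(x j, T) \<in> ?J" "ball_le d q (x j, T)" using i j by blast+
    with q(3) show ?thesis by fastforce
  qed
  with q(1) i(1) show ?thesis by blast
qed

section \<open>The three families of open sets are topologies\<close>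

lemma weight_limsup_tail:
  assumes w: "weight_on X d \<phi>" and fc: "forward_cauchy_net X d I le x"
    and c: "c < net_limsup I le (\<lambda>j. \<phi> (x j))" and e: "(e::real) > 0"
  shows "\<exists>i\<in>I. \<forall>j\<in>I. le i j \<longrightarrow> c \<le> \<phi> (x j) + ennreal e"
proof -
  have dir: "directed_on I le" and xX: "x ` I \<subseteq> X" using fc by (auto simp: forward_cauchy_net_def)
  obtain i where i: "i \<in> I"
    "\<forall>j\<in>I. le i j \<longrightarrow> (\<forall>k\<in>I. le j k \<longrightarrow> d (x j) (x k) \<le> ennreal e)"
    using forward_cauchy_tail[OF fc e] by blast
  have "net_limsup I le (\<lambda>j. \<phi> (x j)) \<le> (SUP k\<in>{k\<in>I. le i k}. \<phi> (x k))"
    unfolding net_limsup_def using i(1) by (rule INF_lower)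
  with c have "c < (SUP k\<in>{k\<in>I. le i k}. \<phi> (x k))" by order
  then obtain k where k: "k \<in> I" "le i k" "c < \<phi> (x k)" by (auto simp: less_SUP_iff)
  have "c \<le> \<phi> (x j) + ennreal e" if j: "j \<in> I" "le k j" for j
  proof -
    have "\<phi> (x k) \<le> \<phi> (x j) + d (x k) (x j)"
      using w xX j(1) k(1) by (auto simp: weight_on_def)
    also have "\<dots> \<le> \<phi> (x j) + ennreal e" using i k j by (intro add_left_mono) auto
    finally show ?thesis using k(3) by order
  qed
  with k(1) show ?thesis by blast
qed

lemma scott_weight_min:
  assumes "scott_weight X d \<phi>" "scott_weight X d \<psi>"
  shows "scott_weight X d (\<lambda>x. min (\<phi> x) (\<psi> x))"
  unfolding scott_weight_def
proof (intro conjI allI impI)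
  have w: "weight_on X d \<phi>" "weight_on X d \<psi>" using assms by (auto simp: scott_weight_def)
  then show "weight_on X d (\<lambda>x. min (\<phi> x) (\<psi> x))"
    unfolding weight_on_def by (metis (no_types, lifting) min.coboundedI1 min.coboundedI2 min_def)
  fix I :: "('a \<times> real) set" and le x p
  assume fc: "forward_cauchy_net X d I le x" and y: "yoneda_limit X d I le x p"
  have dir: "directed_on I le" using fc by (simp add: forward_cauchy_net_def)
  have lim: "\<phi> p \<le> net_limsup I le (\<lambda>j. \<phi> (x j))" "\<psi> p \<le> net_limsup I le (\<lambda>j. \<psi> (x j))"
    using assms fc y by (auto simp: scott_weight_def)
  show "min (\<phi> p) (\<psi> p) \<le> net_limsup I le (\<lambda>j. min (\<phi> (x j)) (\<psi> (x j)))" (is "_ \<le> ?L")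
  proof (rule dense_le)
    fix c assume c: "c < min (\<phi> p) (\<psi> p)"
    show "c \<le> ?L"
    proof (rule ennreal_le_epsilon)
      fix e :: real assume e: "e > 0"
      have "c < net_limsup I le (\<lambda>j. \<phi> (x j))" "c < net_limsup I le (\<lambda>j. \<psi> (x j))"
        using c lim by auto
      from weight_limsup_tail[OF w(1) fc this(1) e] weight_limsup_tail[OF w(2) fc this(2) e]
      obtain i i' where i: "i \<in> I" "\<forall>j\<in>I. le i j \<longrightarrow> c \<le> \<phi> (x j) + ennreal e"
        and i': "i' \<in> I" "\<forall>j\<in>I. le i' j \<longrightarrow> c \<le> \<psi> (x j) + ennreal e"
        by blast
      have "c - ennreal e \<le> ?L"
        unfolding net_limsup_def
      proof (rule INF_greatest)
        fix l assume l: "l \<in> I"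
        obtain m where m: "m \<in> I" "le i m" "le i' m"
          using directed_onD(4)[OF dir i(1) i'(1)] by blast
        obtain k where k: "k \<in> I" "le m k" "le l k" using directed_onD(4)[OF dir m(1) l] by blast
        have "le i k" "le i' k" using directed_onD(3)[OF dir] i(1) i'(1) m k by blast+
        then have "c \<le> \<phi> (x k) + ennreal e" "c \<le> \<psi> (x k) + ennreal e" using i i' k by auto
        then have "c \<le> ennreal e + min (\<phi> (x k)) (\<psi> (x k))"
          by (simp add: min_def add.commute)
        then have "c - ennreal e \<le> min (\<phi> (x k)) (\<psi> (x k))"
          by (subst ennreal_minus_le_iff) auto
        also have "\<dots> \<le> (SUP j\<in>{j\<in>I. le l j}. min (\<phi> (x j)) (\<psi> (x j)))"
          using k by (intro SUP_upper) auto
        finally show "c - ennreal e \<le> (SUP j\<in>{j\<in>I. le l j}. min (\<phi> (x j)) (\<psi> (x j)))" .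
      qed
      then show "c \<le> ?L + ennreal e"
        by (simp add: ennreal_minus_le_iff add.commute)
    qed
  qed
qed

lemma scott_weight_scott_distance: "scott_weight X d (\<lambda>x. scott_distance X d x A)"
  unfolding scott_weight_def
proof (intro conjI allI impI)
  let ?W = "{\<phi>. scott_weight X d \<phi> \<and> (\<forall>a\<in>A. \<phi> a = 0)}"
  show "weight_on X d (\<lambda>x. scott_distance X d x A)"
    unfolding weight_on_def scott_distance_def
  proof (intro ballI SUP_least)
    fix x y \<phi> assume xy: "x \<in> X" "y \<in> X" "\<phi> \<in> ?W"
    then have "\<phi> x \<le> \<phi> y + d x y" by (auto simp: scott_weight_def weight_on_def)
    also have "\<dots> \<le> (SUP \<phi>\<in>?W. \<phi> y) + d x y" using xy by (intro add_right_mono SUP_upper)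
    finally show "\<phi> x \<le> (SUP \<phi>\<in>?W. \<phi> y) + d x y" .
  qed
  fix I :: "('a \<times> real) set" and le x p
  assume fc: "forward_cauchy_net X d I le x" and y: "yoneda_limit X d I le x p"
  show "scott_distance X d p A \<le> net_limsup I le (\<lambda>j. scott_distance X d (x j) A)"
    unfolding scott_distance_def
  proof (rule SUP_least)
    fix \<phi> assume W: "\<phi> \<in> ?W"
    then have "\<phi> p \<le> net_limsup I le (\<lambda>j. \<phi> (x j))"
      using fc y by (auto simp: scott_weight_def)
    also have "\<dots> \<le> net_limsup I le (\<lambda>j. SUP \<phi>\<in>?W. \<phi> (x j))"
      unfolding net_limsup_def
      by (rule INF_mono', rule SUP_mono', rule SUP_upper[OF W])
    finally show "\<phi> p \<le> net_limsup I le (\<lambda>j. SUP \<phi>\<in>?W. \<phi> (x j))" .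
  qed
qed

lemma scott_distance_upper:
  "scott_weight X d \<phi> \<Longrightarrow> \<forall>a\<in>A. \<phi> a = 0 \<Longrightarrow> \<phi> x \<le> scott_distance X d x A"
  unfolding scott_distance_def by (intro SUP_upper) auto

lemma scott_distance_self: "a \<in> A \<Longrightarrow> scott_distance X d a A = 0"
proof -
  assume "a \<in> A"
  then have "scott_distance X d a A \<le> 0" unfolding scott_distance_def by (intro SUP_least) auto
  then show ?thesis by simp
qed

lemma scott_distance_antimono: "A \<subseteq> B \<Longrightarrow> scott_distance X d x B \<le> scott_distance X d x A"
  by (rule scott_distance_upper[of X d _ A x, OF scott_weight_scott_distance])
    (auto simp: scott_distance_self)

lemma scott_distance_Un:
  assumes "scott_distance X d x (A \<union> B) = 0"
  shows "scott_distance X d x A = 0 \<or> scott_distance X d x B = 0"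
proof -
  have "min (scott_distance X d x A) (scott_distance X d x B) \<le> scott_distance X d x (A \<union> B)"
    by (rule scott_distance_upper[OF scott_weight_min])
      (auto simp: scott_weight_scott_distance scott_distance_self)
  with assms show ?thesis by (auto simp: min_def split: if_splits)
qed

lemma istopology_c_scott:
  "istopology (\<lambda>U. U \<subseteq> X \<and> (\<forall>x\<in>X. scott_distance X d x (X - U) = 0 \<longrightarrow> x \<in> X - U))"
  unfolding istopology_def
proof (intro conjI allI impI)
  fix S T assume S: "S \<subseteq> X \<and> (\<forall>x\<in>X. scott_distance X d x (X - S) = 0 \<longrightarrow> x \<in> X - S)"
    and T: "T \<subseteq> X \<and> (\<forall>x\<in>X. scott_distance X d x (X - T) = 0 \<longrightarrow> x \<in> X - T)"
  have eq: "X - S \<inter> T = (X - S) \<union> (X - T)" by blast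
  from S T show "S \<inter> T \<subseteq> X" "\<forall>x\<in>X. scott_distance X d x (X - S \<inter> T) = 0 \<longrightarrow> x \<in> X - S \<inter> T"
    unfolding eq using scott_distance_Un[of X d _ "X - S" "X - T"] by (blast, blast)
next
  fix K assume K: "\<forall>U\<in>K. U \<subseteq> X \<and> (\<forall>x\<in>X. scott_distance X d x (X - U) = 0 \<longrightarrow> x \<in> X - U)"
  then show "\<Union>K \<subseteq> X" by blast
  show "\<forall>x\<in>X. scott_distance X d x (X - \<Union>K) = 0 \<longrightarrow> x \<in> X - \<Union>K"
  proof (intro ballI impI)
    fix x assume x: "x \<in> X" "scott_distance X d x (X - \<Union>K) = 0"
    have "scott_distance X d x (X - U) = 0" if "U \<in> K" for U
    proof -
      have "X - \<Union>K \<subseteq> X - U" using that by blast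
      from scott_distance_antimono[OF this, of X d x] x(2) show ?thesis by simp
    qed
    with K x(1) show "x \<in> X - \<Union>K" by blast
  qed
qed

lemma openin_c_scott:
  "openin (c_scott_topology X d) U \<longleftrightarrow>
     U \<subseteq> X \<and> (\<forall>x\<in>X. scott_distance X d x (X - U) = 0 \<longrightarrow> x \<in> X - U)"
  unfolding c_scott_topology_def topology_inverse'[OF istopology_c_scott] ..

lemma topspace_c_scott [simp]: "topspace (c_scott_topology X d) = X"
proof -
  have "scott_weight X d (\<lambda>_. top)"
    by (auto simp: scott_weight_def weight_on_def net_limsup_def forward_cauchy_net_def
        dest!: directed_onD(2) intro!: INF_greatest SUP_upper2)
  then have "scott_distance X d x {} = top" for x
    using scott_distance_upper[of X d "\<lambda>_. top" "{}" x] by (simp add: top_unique)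
  then have "openin (c_scott_topology X d) X" by (simp add: openin_c_scott)
  then show ?thesis by (meson openin_c_scott openin_subset openin_topspace subset_antisym)
qed

lemma closedin_c_scott:
  "closedin (c_scott_topology X d) A \<longleftrightarrow> (\<exists>\<phi>. scott_weight X d \<phi> \<and> A = {x\<in>X. \<phi> x = 0})"
proof
  assume A: "closedin (c_scott_topology X d) A"
  then have "A \<subseteq> X" using closedin_subset by fastforce
  then have "X - (X - A) = A" by blast
  with A \<open>A \<subseteq> X\<close> have "A = {x\<in>X. scott_distance X d x A = 0}"
    by (auto simp: closedin_def openin_c_scott scott_distance_self)
  then show "\<exists>\<phi>. scott_weight X d \<phi> \<and> A = {x\<in>X. \<phi> x = 0}"
    using scott_weight_scott_distance by blast
next
  assume "\<exists>\<phi>. scott_weight X d \<phi> \<and> A = {x\<in>X. \<phi> x = 0}"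
  then obtain \<phi> where \<phi>: "scott_weight X d \<phi>" "A = {x\<in>X. \<phi> x = 0}" by blast
  then have AX: "A \<subseteq> X" "X - (X - A) = A" by auto
  have "x \<in> A" if "x \<in> X" "scott_distance X d x A = 0" for x
    using scott_distance_upper[OF \<phi>(1), of A x] \<phi>(2) that by auto
  with AX show "closedin (c_scott_topology X d) A"
    by (auto simp: closedin_def openin_c_scott)
qed

lemma closure_of_c_scott:
  assumes "A \<subseteq> X"
  shows "c_scott_topology X d closure_of A = {x\<in>X. scott_distance X d x A = 0}" (is "?L = ?R")
proof
  show "?L \<subseteq> ?R"
  proof (rule closure_of_minimal)
    show "A \<subseteq> ?R" using assms by (auto simp: scott_distance_self)
    show "closedin (c_scott_topology X d) ?R"
      unfolding closedin_c_scott using scott_weight_scott_distance by blast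
  qed
  have "closedin (c_scott_topology X d) ?L" by simp
  then obtain \<phi> where \<phi>: "scott_weight X d \<phi>" "?L = {x\<in>X. \<phi> x = 0}"
    unfolding closedin_c_scott by blast
  have "A \<subseteq> ?L" using assms by (intro closure_of_subset) simp
  with \<phi> have "\<phi> x \<le> scott_distance X d x A" for x
    by (intro scott_distance_upper) auto
  then show "?R \<subseteq> ?L" using \<phi>(2) by (metis (mono_tags, lifting) le_zero_eq mem_Collect_eq subsetI)
qed

lemma istopology_generalized_scott: "istopology (generalized_scott_open X d)"
  unfolding istopology_def
proof (intro conjI allI impI)
  fix S T assume S: "generalized_scott_open X d S" and T: "generalized_scott_open X d T"
  show "generalized_scott_open X d (S \<inter> T)"
    unfolding generalized_scott_open_def
  proof (intro conjI allI impI)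
    show "S \<inter> T \<subseteq> X" using S by (auto simp: generalized_scott_open_def)
    fix I :: "('a \<times> real) set" and le x p
    assume fc: "forward_cauchy_net X d I le x" and y: "yoneda_limit X d I le x p" and p: "p \<in> S \<inter> T"
    have dir: "directed_on I le" using fc by (simp add: forward_cauchy_net_def)
    obtain e i where i: "e > 0" "i \<in> I" "\<forall>j\<in>I. le i j \<longrightarrow> metric_ball X d (x j) e \<subseteq> S"
      using S fc y p unfolding generalized_scott_open_def by (metis IntD1)
    obtain f l where l: "f > 0" "l \<in> I" "\<forall>j\<in>I. le l j \<longrightarrow> metric_ball X d (x j) f \<subseteq> T"
      using T fc y p unfolding generalized_scott_open_def by (metis IntD2)
    obtain k where k: "k \<in> I" "le i k" "le l k" using directed_onD(4)[OF dir i(2) l(2)] by blast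
    have "metric_ball X d (x j) (min e f) \<subseteq> S \<inter> T" if j: "j \<in> I" "le k j" for j
    proof -
      have "le i j" "le l j" using directed_onD(3)[OF dir] i(2) l(2) k j by blast+
      moreover have "metric_ball X d (x j) (min e f) \<subseteq> metric_ball X d (x j) e \<inter> metric_ball X d (x j) f"
        unfolding metric_ball_def
        by (auto intro: order_less_le_trans[OF _ ennreal_leI[OF min.cobounded1]]
            order_less_le_trans[OF _ ennreal_leI[OF min.cobounded2]])
      ultimately show ?thesis using i(3) l(3) j(1) by blast
    qed
    with k(1) i(1) l(1) show "\<exists>\<epsilon>>0. \<exists>i\<in>I. \<forall>j\<in>I. le i j \<longrightarrow> metric_ball X d (x j) \<epsilon> \<subseteq> S \<inter> T"
      by (intro exI[of _ "min e f"] conjI bexI[of _ k]) auto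
  qed
next
  fix K assume K: "\<forall>U\<in>K. generalized_scott_open X d U"
  show "generalized_scott_open X d (\<Union>K)"
    unfolding generalized_scott_open_def
  proof (intro conjI allI impI)
    show "\<Union>K \<subseteq> X" using K by (auto simp: generalized_scott_open_def)
    fix I :: "('a \<times> real) set" and le x p
    assume fc: "forward_cauchy_net X d I le x" and y: "yoneda_limit X d I le x p" and "p \<in> \<Union>K"
    then obtain U where U: "U \<in> K" "p \<in> U" by blast
    with K have "generalized_scott_open X d U" by blast
    with U(2) fc y have "\<exists>\<epsilon>>0. \<exists>i\<in>I. \<forall>j\<in>I. le i j \<longrightarrow> metric_ball X d (x j) \<epsilon> \<subseteq> U"
      unfolding generalized_scott_open_def by blast
    with U(1) show "\<exists>\<epsilon>>0. \<exists>i\<in>I. \<forall>j\<in>I. le i j \<longrightarrow> metric_ball X d (x j) \<epsilon> \<subseteq> \<Union>K"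
      by (meson Union_upper subset_trans)
  qed
qed

lemma openin_generalized_scott:
  "openin (generalized_scott_topology X d) U \<longleftrightarrow> generalized_scott_open X d U"
  unfolding generalized_scott_topology_def
  by (simp add: topology_inverse'[OF istopology_generalized_scott])

lemma topspace_generalized_scott [simp]: "topspace (generalized_scott_topology X d) = X"
proof -
  have "generalized_scott_open X d X"
    unfolding generalized_scott_open_def
  proof (intro conjI allI impI)
    fix I :: "('a \<times> real) set" and le and x :: "'a \<times> real \<Rightarrow> 'a"
    assume "forward_cauchy_net X d I le x"
    then obtain i where "i \<in> I" by (auto simp: forward_cauchy_net_def directed_on_def)
    then show "\<exists>\<epsilon>>0. \<exists>i\<in>I. \<forall>j\<in>I. le i j \<longrightarrow> metric_ball X d (x j) \<epsilon> \<subseteq> X"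
      by (intro exI[of _ 1] conjI bexI[of _ i]) (auto simp: metric_ball_def)
  qed simp
  then show ?thesis
    by (metis openin_generalized_scott generalized_scott_open_def openin_subset openin_topspace
        subset_antisym)
qed

lemma istopology_scott: "istopology (\<lambda>U. U \<subseteq> P \<and> scott_closed P le (P - U))"
  unfolding istopology_def
proof (intro conjI allI impI)
  fix S T assume S: "S \<subseteq> P \<and> scott_closed P le (P - S)" and T: "T \<subseteq> P \<and> scott_closed P le (P - T)"
  then show "S \<inter> T \<subseteq> P" by blast
  show "scott_closed P le (P - S \<inter> T)"
    unfolding scott_closed_def
  proof (intro conjI allI impI)
    show "P - S \<inter> T \<subseteq> P" by blast
    show "\<forall>a\<in>P. \<forall>b\<in>P - S \<inter> T. le a b \<longrightarrow> a \<in> P - S \<inter> T"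
      using S T unfolding scott_closed_def by blast
    fix D z assume D: "D \<subseteq> P - S \<inter> T" "directed_on D le" "is_join P le D z"
    have "D \<subseteq> P - S \<or> D \<subseteq> P - T"
    proof (rule ccontr)
      assume "\<not> ?thesis"
      then obtain a b where ab: "a \<in> D" "a \<in> S" "b \<in> D" "b \<in> T" using D(1) by blast
      obtain c where c: "c \<in> D" "le a c" "le b c" using directed_onD(4)[OF D(2) ab(1,3)] by blast
      have "c \<in> P" "a \<in> P" "b \<in> P" using c(1) ab S T D(1) by blast+
      have "c \<notin> P - S"
        using S ab(2) c(2) \<open>a \<in> P\<close> unfolding scott_closed_def by (metis Diff_iff)
      moreover have "c \<notin> P - T"
        using T ab(4) c(3) \<open>b \<in> P\<close> unfolding scott_closed_def by (metis Diff_iff)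
      ultimately have "c \<in> S" "c \<in> T" using \<open>c \<in> P\<close> by blast+
      with c(1) D(1) show False by blast
    qed
    then have "z \<in> P - S \<or> z \<in> P - T" using S T D(2,3) unfolding scott_closed_def by meson
    then show "z \<in> P - S \<inter> T" by blast
  qed
next
  fix K assume K: "\<forall>U\<in>K. U \<subseteq> P \<and> scott_closed P le (P - U)"
  then show "\<Union>K \<subseteq> P" by blast
  show "scott_closed P le (P - \<Union>K)"
    unfolding scott_closed_def
  proof (intro conjI allI impI)
    show "P - \<Union>K \<subseteq> P" by blast
    show "\<forall>a\<in>P. \<forall>b\<in>P - \<Union>K. le a b \<longrightarrow> a \<in> P - \<Union>K"
      using K unfolding scott_closed_def by blast
    fix D z assume D: "D \<subseteq> P - \<Union>K" "directed_on D le" "is_join P le D z"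
    have "z \<in> P - U" if "U \<in> K" for U
    proof -
      have "D \<subseteq> P - U" using D(1) that by blast
      then show ?thesis using K that D(2,3) unfolding scott_closed_def by meson
    qed
    moreover have "z \<in> P" using D(3) by (simp add: is_join_def)
    ultimately show "z \<in> P - \<Union>K" by blast
  qed
qed

lemma openin_scott: "openin (scott_topology P le) U \<longleftrightarrow> U \<subseteq> P \<and> scott_closed P le (P - U)"
  unfolding scott_topology_def topology_inverse'[OF istopology_scott] ..

lemma topspace_scott [simp]: "topspace (scott_topology P le) = P"
proof -
  have "scott_closed P le {}" by (auto simp: scott_closed_def directed_on_def)
  then have "openin (scott_topology P le) P" by (simp add: openin_scott)
  then show ?thesis by (meson openin_scott openin_subset openin_topspace subset_antisym)
qed

lemma topspace_d_scott [simp]: "topspace (d_scott_topology X d) = X"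
  unfolding d_scott_topology_def by (auto simp: topspace_pullback_topology formal_balls_def)

end

(*
  A Scott weight phi that is positive at a Yoneda limit p of a forward Cauchy net stays bounded
  away from 0 along a tail of the net, and hence, by the weight inequality, on balls of a fixed
  radius about the points of the tail; so the complement of its zero set is generalized Scott open.

  A Scott closed set C of formal balls gives the weight phi(x) = inf {r | (x,r) in C}. Its zero set
  is the trace of C on X because (x,0) is the join of the balls (x,r) with r > 0. It is a Scott
  weight because (p,c) is the join of the directed set of balls (x_j, r + c), where r exceeds
  the supremum of d(x_j,x_k) over k >= j.
*)
theory Submission
  imports Defs
begin

section \<open>Zero sets of Scott weights and generalized Scott open sets\<close>

lemma generalized_scott_open_scott_weight:
  assumes \<phi>: "scott_weight X d \<phi>"
  shows "generalized_scott_open X d {x\<in>X. \<phi> x \<noteq> 0}"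
  unfolding generalized_scott_open_def
proof (intro conjI allI impI)
  fix I :: "('a \<times> real) set" and le x p
  assume fc: "forward_cauchy_net X d I le x" and y: "yoneda_limit X d I le x p"
    and p: "p \<in> {x\<in>X. \<phi> x \<noteq> 0}"
  have w: "weight_on X d \<phi>" and lim: "\<phi> p \<le> net_limsup I le (\<lambda>j. \<phi> (x j))"
    using \<phi> fc y by (auto simp: scott_weight_def)
  have xX: "x ` I \<subseteq> X" using fc by (simp add: forward_cauchy_net_def)
  \<comment> \<open>As \<open>\<phi> p\<close> may be infinite, a value strictly below it is chosen,
    which is a positive real \<open>c\<close>.\<close>
  obtain q where q: "0 < q" "q < \<phi> p" using p dense[of 0 "\<phi> p"] by (auto simp: zero_less_iff_neq_zero)
  then obtain c where c: "q = ennreal c" "c > 0" by (cases q) auto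
  \<comment> \<open>One \<open>e\<close> is lost in passing to a tail of the net, another in passing
    from \<open>x j\<close> to a point of its ball; since \<open>2 * e < c\<close>, something
    positive remains.\<close>
  define e where "e = c / 3"
  have e: "e > 0" "2 * e < c" using c by (simp_all add: e_def)
  have "ennreal c < net_limsup I le (\<lambda>j. \<phi> (x j))" using q c lim by order
  then obtain i where i: "i \<in> I" "\<forall>j\<in>I. le i j \<longrightarrow> ennreal c \<le> \<phi> (x j) + ennreal e"
    using weight_limsup_tail[OF w fc _ e(1)] by blast
  have "metric_ball X d (x j) e \<subseteq> {x\<in>X. \<phi> x \<noteq> 0}" if j: "j \<in> I" "le i j" for j
  proof
    fix z assume z: "z \<in> metric_ball X d (x j) e"
    then have "\<phi> (x j) \<le> \<phi> z + d (x j) z"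
      using w xX j(1) by (auto simp: weight_on_def metric_ball_def)
    also have "\<dots> \<le> \<phi> z + ennreal e" using z by (intro add_left_mono) (auto simp: metric_ball_def)
    finally have "\<phi> (x j) + ennreal e \<le> \<phi> z + ennreal e + ennreal e" by (rule add_right_mono)
    with i j have "ennreal c \<le> \<phi> z + ennreal e + ennreal e" by (meson order_trans)
    also have "\<dots> = \<phi> z + ennreal (2 * e)" using e by (simp add: add.assoc flip: ennreal_plus)
    finally have "\<phi> z \<noteq> 0" using e by auto
    with z show "z \<in> {x\<in>X. \<phi> x \<noteq> 0}" by (simp add: metric_ball_def)
  qed
  with i(1) e(1)
  show "\<exists>\<epsilon>>0. \<exists>i\<in>I. \<forall>j\<in>I. le i j \<longrightarrow> metric_ball X d (x j) \<epsilon> \<subseteq> {x\<in>X. \<phi> x \<noteq> 0}"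
    by blast
qed auto

section \<open>Joins of formal balls\<close>

text \<open>The finite summand \<open>c\<close> cancels in \<open>ennreal\<close>. This lets a
  constant be added to all radii without changing the order.\<close>

lemma ball_le_shift:
  assumes "0 \<le> r" "0 \<le> s" "0 \<le> c"
  shows "ball_le d (a, r + c) (b, s + c) \<longleftrightarrow> ball_le d (a, r) (b, s)"
proof -
  have "ennreal (s + c) + d a b = ennreal c + (ennreal s + d a b)" "ennreal (r + c) = ennreal c + ennreal r"
    using assms by (simp_all add: ennreal_plus ac_simps)
  then show ?thesis
    unfolding ball_le_def fst_conv snd_conv by (simp only: ennreal_add_left_cancel_le) simp
qed

lemma directed_on_image:
  assumes "directed_on I le" and "\<And>i j. i \<in> I \<Longrightarrow> j \<in> I \<Longrightarrow> le' (f i) (f j) \<longleftrightarrow> le i j"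
  shows "directed_on (f ` I) le'"
  unfolding directed_on_def
proof (intro conjI)
  show "f ` I \<noteq> {}" using directed_onD(1)[OF assms(1)] by blast
  show "reflp_on (f ` I) le'" using directed_onD(2)[OF assms(1)] assms(2) by (auto intro!: reflp_onI)
  show "transp_on (f ` I) le'"
  proof (rule transp_onI)
    fix u v w assume "u \<in> f ` I" "v \<in> f ` I" "w \<in> f ` I" "le' u v" "le' v w"
    then obtain i j k where "u = f i" "v = f j" "w = f k" "i \<in> I" "j \<in> I" "k \<in> I" "le i j" "le j k"
      using assms(2) by blast
    with directed_onD(3)[OF assms(1)] assms(2) show "le' u w" by blast
  qed
  show "\<forall>u\<in>f ` I. \<forall>v\<in>f ` I. \<exists>w\<in>f ` I. le' u w \<and> le' v w"
  proof (intro ballI)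
    fix u v assume "u \<in> f ` I" "v \<in> f ` I"
    then obtain i j where ij: "u = f i" "v = f j" "i \<in> I" "j \<in> I" by blast
    then obtain k where "k \<in> I" "le i k" "le j k" using directed_onD(4)[OF assms(1)] by blast
    with ij assms(2) show "\<exists>w\<in>f ` I. le' u w \<and> le' v w" by blast
  qed
qed

text \<open>An upper bound \<open>u\<close> has \<open>snd u + d a (fst u)\<close> below every
  positive radius, so this sum vanishes.\<close>

lemma is_join_shrinking_balls:
  assumes m: "lawvere_metric X d" and a: "a \<in> X"
  shows "is_join (formal_balls X) (ball_le d) ((\<lambda>r. (a, r)) ` {0<..}) (a, 0)"
proof -
  have "ball_le d (a, 0) u"
    if u: "u \<in> formal_balls X" "\<forall>v\<in>(\<lambda>r. (a, r)) ` {0<..}. ball_le d v u" for u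
  proof -
    have "ennreal (snd u) + d a (fst u) \<le> 0 + ennreal e" if "e > 0" for e
      using u(2) that by (auto simp: ball_le_def)
    then have "ennreal (snd u) + d a (fst u) \<le> 0" by (rule ennreal_le_epsilon)
    then show ?thesis by (simp add: ball_le_def)
  qed
  with m a show ?thesis by (auto simp: is_join_def formal_balls_def ball_le_def lawvere_metric_def)
qed

lemma directed_on_shrinking_balls:
  assumes m: "lawvere_metric X d" and a: "a \<in> X"
  shows "directed_on ((\<lambda>r. (a, r)) ` {0<..}) (ball_le d)"
\<comment> \<open>Among balls with a common centre, the larger ones in the order have smaller
  radii.\<close>
proof (rule directed_on_image[where le = "(\<ge>)"])
  show "directed_on {0<..} ((\<ge>) :: real \<Rightarrow> real \<Rightarrow> bool)"
    unfolding directed_on_def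
  proof (intro conjI ballI)
    fix r s :: real assume "r \<in> {0<..}" "s \<in> {0<..}"
    then show "\<exists>t\<in>{0<..}. t \<le> r \<and> t \<le> s" by (intro bexI[of _ "min r s"]) auto
  qed (auto intro: reflp_onI transp_onI)
qed (use m a in \<open>auto simp: ball_le_def lawvere_metric_def\<close>)

text \<open>The gap \<open>r - s\<close> in the definition of \<open>ball_index\<close> bounds the
  step from a late \<open>x k\<close> to \<open>p\<close>, and \<open>s\<close> bounds the step from
  \<open>a\<close> to \<open>x k\<close>.\<close>

lemma yoneda_limit_dist_le:
  assumes m: "lawvere_metric X d" and fc: "forward_cauchy_net X d I le x"
    and y: "yoneda_limit X d I le x p" and "(a, r) \<in> ball_index d I le x"
  shows "d a p \<le> ennreal r"
proof -
  obtain j s where j: "a = x j" "j \<in> I" "0 \<le> s" "s < r"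
    "\<And>k. k \<in> I \<Longrightarrow> le j k \<Longrightarrow> d (x j) (x k) \<le> ennreal s"
    using ball_indexE[OF assms(4)] by (metis prod.inject)
  have dir: "directed_on I le" and xX: "x ` I \<subseteq> X" using fc by (auto simp: forward_cauchy_net_def)
  have pX: "p \<in> X" using y by (simp add: yoneda_limit_def)
  \<comment> \<open>This is the Yoneda condition at the limit itself, where
    \<open>d p p = 0\<close>.\<close>
  have "net_limsup I le (\<lambda>j. d (x j) p) = 0"
    using m y pX by (metis yoneda_limit_def lawvere_metric_def)
  then have "net_limsup I le (\<lambda>j. d (x j) p) < ennreal (r - s)" using j by simp
  then obtain i where i: "i \<in> I" "(SUP j\<in>{j\<in>I. le i j}. d (x j) p) < ennreal (r - s)"
    by (auto simp: net_limsup_def INF_less_iff)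
  obtain k where k: "k \<in> I" "le i k" "le j k" using directed_onD(4)[OF dir i(1) j(2)] by blast
  have "d (x k) p \<le> (SUP j\<in>{j\<in>I. le i j}. d (x j) p)" using k by (intro SUP_upper) auto
  then have kp: "d (x k) p \<le> ennreal (r - s)" using i(2) by order
  have "d (x j) p \<le> d (x j) (x k) + d (x k) p"
    using m xX j(2) k(1) pX unfolding lawvere_metric_def by blast
  also have "\<dots> \<le> ennreal s + ennreal (r - s)" using j(5)[OF k(1,3)] kp by (rule add_mono)
  also have "\<dots> = ennreal r" using j by (simp flip: ennreal_plus)
  finally show ?thesis by (simp add: j(1))
qed

text \<open>That \<open>(p, c)\<close> is an upper bound is \<open>yoneda_limit_dist_le\<close> with
  all radii shifted by \<open>c\<close>. It is least because radii \<open>e + c\<close> with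
  \<open>e\<close> arbitrarily small occur along tails of the net, and the Yoneda condition bounds
  \<open>d p b\<close> by the supremum over any tail.\<close>

lemma is_join_ball_index:
  assumes m: "lawvere_metric X d" and fc: "forward_cauchy_net X d I le x"
    and y: "yoneda_limit X d I le x p" and c: "(c::real) \<ge> 0"
  shows "is_join (formal_balls X) (ball_le d)
    ((\<lambda>(a, r). (a, r + c)) ` ball_index d I le x) (p, c)"
  unfolding is_join_def
proof (intro conjI ballI impI)
  let ?J = "ball_index d I le x"
  have pX: "p \<in> X" using y by (simp add: yoneda_limit_def)
  with c show "(p, c) \<in> formal_balls X" by (simp add: formal_balls_def)
  have nonneg: "0 \<le> r" if "(a, r) \<in> ?J" for a r using that by (auto elim!: ball_indexE)
  show "ball_le d v (p, c)" if v: "v \<in> (\<lambda>(a, r). (a, r + c)) ` ?J" for v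
  proof -
    obtain a r where a: "v = (a, r + c)" "(a, r) \<in> ?J" using v by auto
    have "ball_le d (a, r) (p, 0)" using yoneda_limit_dist_le[OF m fc y a(2)] by (simp add: ball_le_def)
    then show ?thesis using ball_le_shift[of r 0 c d a p] nonneg[OF a(2)] c a(1) by simp
  qed
  fix u assume u: "u \<in> formal_balls X" "\<forall>v\<in>(\<lambda>(a, r). (a, r + c)) ` ?J. ball_le d v u"
  obtain b t where b: "u = (b, t)" "b \<in> X" "t \<ge> 0" using u(1) by (auto simp: formal_balls_def)
  obtain i where i: "i \<in> I" using fc by (auto simp: forward_cauchy_net_def directed_on_def)
  have "ennreal t + d p b \<le> ennreal c + ennreal e" if e: "e > 0" for e
  proof -
    obtain l where l: "l \<in> I" "\<forall>k\<in>I. le l k \<longrightarrow> (x k, e) \<in> ?J"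
      using ball_index_small[OF fc e i] by blast
    have le: "ennreal t + d (x k) b \<le> ennreal c + ennreal e" if "k \<in> I" "le l k" for k
      using u(2) l(2) that c e by (force simp: b ball_le_def ennreal_plus add.commute)
    have "le l l" using fc l(1) directed_onD(2) by (auto simp: forward_cauchy_net_def)
    with le l(1) have t: "ennreal t \<le> ennreal c + ennreal e" by (meson add_increasing2 le_iff_add order_trans)
    have "d p b \<le> (SUP k\<in>{k\<in>I. le l k}. d (x k) b)"
      using y b(2) l(1) by (auto simp: yoneda_limit_def net_limsup_def intro: INF_lower)
    \<comment> \<open>The radius \<open>t\<close> is moved to the right so that the supremum can be
      bounded termwise. Subtraction is truncated, so adding \<open>t\<close> back relies on the
      bound on \<open>t\<close> obtained above.\<close>
    also have "\<dots> \<le> ennreal c + ennreal e - ennreal t"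
    proof (rule SUP_least)
      fix k assume "k \<in> {k\<in>I. le l k}"
      then have "ennreal t + d (x k) b - ennreal t \<le> ennreal c + ennreal e - ennreal t"
        using le by (intro ennreal_minus_mono) auto
      then show "d (x k) b \<le> ennreal c + ennreal e - ennreal t" by simp
    qed
    finally have "ennreal t + d p b \<le> ennreal t + (ennreal c + ennreal e - ennreal t)"
      by (rule add_left_mono)
    also have "\<dots> = ennreal c + ennreal e" using t by (simp add: add_diff_inverse_ennreal)
    finally show ?thesis .
  qed
  then show "ball_le d (p, c) u" by (simp add: b(1) ball_le_def ennreal_le_epsilon)
qed

lemma directed_on_ball_index:
  assumes m: "lawvere_metric X d" and fc: "forward_cauchy_net X d I le x" and c: "(c::real) \<ge> 0"
  shows "directed_on ((\<lambda>(a, r). (a, r + c)) ` ball_index d I le x) (ball_le d)"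
proof (rule directed_on_image)
  show "directed_on (ball_index d I le x) (ball_le d)"
    using forward_cauchy_ball_index[OF m fc] by (simp add: forward_cauchy_net_def)
  fix u v assume "u \<in> ball_index d I le x" "v \<in> ball_index d I le x"
  then have "0 \<le> snd u" "0 \<le> snd v" by (auto elim!: ball_indexE)
  then show "ball_le d (case u of (a, r) \<Rightarrow> (a, r + c)) (case v of (a, r) \<Rightarrow> (a, r + c)) = ball_le d u v"
    using c by (cases u; cases v) (simp add: ball_le_shift)
qed

section \<open>The weight of a Scott closed set of formal balls\<close>

text \<open>The infimum is \<open>\<top>\<close> if no ball centred at \<open>x\<close> lies in \<open>C\<close>.\<close>

definition ball_weight :: "('a \<times> real) set \<Rightarrow> 'a \<Rightarrow> ennreal" where
  "ball_weight C x = (INF r\<in>{r. (x, r) \<in> C}. ennreal r)"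

lemma ball_weight_le: "(x, r) \<in> C \<Longrightarrow> ball_weight C x \<le> ennreal r"
  unfolding ball_weight_def by (intro INF_lower) simp

lemma scott_closed_lower:
  assumes "scott_closed (formal_balls X) (ball_le d) C"
    and "(y, s) \<in> C" "x \<in> X" "0 \<le> r" "ennreal s + d x y \<le> ennreal r"
  shows "(x, r) \<in> C"
proof -
  have "(x, r) \<in> formal_balls X" "ball_le d (x, r) (y, s)"
    using assms by (simp_all add: formal_balls_def ball_le_def)
  with assms(1,2) show ?thesis unfolding scott_closed_def by blast
qed

lemma scott_closed_radius_nonneg:
  "scott_closed (formal_balls X) le C \<Longrightarrow> (x, r) \<in> C \<Longrightarrow> 0 \<le> r"
  by (auto simp: scott_closed_def formal_balls_def)

text \<open>The infimum may not be attained, but a strict inequality yields a smaller radius in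
  \<open>C\<close>, and enlarging the radius goes down in the order.\<close>

lemma mem_if_ball_weight_less:
  assumes m: "lawvere_metric X d" and C: "scott_closed (formal_balls X) (ball_le d) C"
    and x: "x \<in> X" and less: "ball_weight C x < ennreal c"
  shows "(x, c) \<in> C"
proof -
  obtain r where r: "(x, r) \<in> C" "ennreal r < ennreal c"
    using less by (auto simp: ball_weight_def INF_less_iff)
  \<comment> \<open>\<open>ennreal\<close> sends negative reals to 0, and nothing is below
    0.\<close>
  have "0 \<le> c" using r(2) by (metis ennreal_neg linorder_le_cases not_less_zero)
  moreover have "ennreal r + d x x \<le> ennreal c" using m x r(2) by (simp add: lawvere_metric_def)
  ultimately show ?thesis using scott_closed_lower[OF C r(1) x] by blast
qed

text \<open>If \<open>(y, r)\<close> lies in \<open>C\<close>, so does the ball of radius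
  \<open>r + d x y\<close> about \<open>x\<close>, which is below it.\<close>

lemma weight_on_ball_weight:
  assumes C: "scott_closed (formal_balls X) (ball_le d) C"
  shows "weight_on X d (ball_weight C)"
  unfolding weight_on_def
proof (intro ballI)
  fix x y assume xy: "x \<in> X" "y \<in> X"
  show "ball_weight C x \<le> ball_weight C y + d x y"
  proof (rule dense_ge)
    fix q assume q: "ball_weight C y + d x y < q"
    \<comment> \<open>Radii of formal balls are real, so the distance must be finite;
      \<open>q\<close> lying strictly above the sum ensures this.\<close>
    then have "d x y \<noteq> top" using top.not_eq_extremum by fastforce
    then obtain D where D: "d x y = ennreal D" "D \<ge> 0" by (cases "d x y") auto
    have "ball_weight C y < q - d x y" using q D by (simp add: less_diff_eq_ennreal)
    then obtain r where r: "(y, r) \<in> C" "ennreal r < q - d x y"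
      by (auto simp: ball_weight_def INF_less_iff)
    have r0: "0 \<le> r" using scott_closed_radius_nonneg[OF C r(1)] .
    have "(x, r + D) \<in> C" using r0 D by (intro scott_closed_lower[OF C r(1) xy(1)]) simp_all
    then have "ball_weight C x \<le> ennreal r + d x y"
      using ball_weight_le D r0 by (metis ennreal_plus)
    also have "\<dots> < q" using r(2) D by (simp add: less_diff_eq_ennreal)
    finally show "ball_weight C x \<le> q" by simp
  qed
qed

lemma scott_weight_ball_weight:
  assumes m: "lawvere_metric X d" and C: "scott_closed (formal_balls X) (ball_le d) C"
  shows "scott_weight X d (ball_weight C)"
  unfolding scott_weight_def
proof (intro conjI allI impI)
  show w: "weight_on X d (ball_weight C)" by (rule weight_on_ball_weight[OF C])
  fix I :: "('a \<times> real) set" and le x p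
  assume fc: "forward_cauchy_net X d I le x" and y: "yoneda_limit X d I le x p"
  have dir: "directed_on I le" and xX: "x ` I \<subseteq> X" using fc by (auto simp: forward_cauchy_net_def)
  show "ball_weight C p \<le> net_limsup I le (\<lambda>j. ball_weight C (x j))"
  proof (rule dense_ge)
    fix q assume q: "net_limsup I le (\<lambda>j. ball_weight C (x j)) < q"
    show "ball_weight C p \<le> q"
    proof (cases q)
      case (real c)
      obtain i where i: "i \<in> I" "(SUP j\<in>{j\<in>I. le i j}. ball_weight C (x j)) < ennreal c"
        using q real by (auto simp: net_limsup_def INF_less_iff)
      \<comment> \<open>A late \<open>x k\<close> has weight at most \<open>c\<close>, and moving
        back to \<open>x j\<close> costs at most \<open>s\<close>; \<open>s < r\<close> gives the
        strict inequality needed for membership.\<close>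
      have "(x j, r + c) \<in> C"
        if j: "j \<in> I" "0 \<le> s" "s < r" "\<And>k. k \<in> I \<Longrightarrow> le j k \<Longrightarrow> d (x j) (x k) \<le> ennreal s" for j r s
      proof (rule mem_if_ball_weight_less[OF m C])
        show "x j \<in> X" using xX j(1) by blast
        obtain k where k: "k \<in> I" "le i k" "le j k"
          using directed_onD(4)[OF dir i(1) j(1)] by blast
        have "ball_weight C (x k) \<le> (SUP j\<in>{j\<in>I. le i j}. ball_weight C (x j))"
          using k by (intro SUP_upper) auto
        with i(2) have "ball_weight C (x k) \<le> ennreal c" by order
        moreover have "ball_weight C (x j) \<le> ball_weight C (x k) + d (x j) (x k)"
          using w xX j(1) k(1) by (auto simp: weight_on_def)
        ultimately have "ball_weight C (x j) \<le> ennreal c + ennreal s"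
          using j(4)[OF k(1,3)] by (meson add_mono order_trans)
        also have "\<dots> < ennreal (r + c)" using j(2,3) real(1) by (simp add: ennreal_lessI flip: ennreal_plus)
        finally show "ball_weight C (x j) < ennreal (r + c)" .
      qed
      then have "(\<lambda>(a, r). (a, r + c)) ` ball_index d I le x \<subseteq> C" by (auto elim!: ball_indexE)
      then have "(p, c) \<in> C"
        using C directed_on_ball_index[OF m fc] is_join_ball_index[OF m fc y] real(1)
        unfolding scott_closed_def by blast
      then show ?thesis using ball_weight_le real(2) by simp
    qed simp
  qed
qed

text \<open>An infimum of 0 is attained since \<open>C\<close> contains the join of the shrinking
  balls about \<open>x\<close>.\<close>

lemma ball_weight_eq_0_iff:
  assumes m: "lawvere_metric X d" and C: "scott_closed (formal_balls X) (ball_le d) C" and x: "x \<in> X"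
  shows "ball_weight C x = 0 \<longleftrightarrow> (x, 0) \<in> C"
proof
  assume "(x, 0) \<in> C"
  then show "ball_weight C x = 0" using ball_weight_le by fastforce
next
  assume "ball_weight C x = 0"
  then have "(\<lambda>r. (x, r)) ` {0<..} \<subseteq> C" using mem_if_ball_weight_less[OF m C x] by auto
  then show "(x, 0) \<in> C"
    using C directed_on_shrinking_balls[OF m x] is_join_shrinking_balls[OF m x]
    unfolding scott_closed_def by blast
qed

section \<open>Comparison of the three topologies through zero sets of Scott weights\<close>

theorem theorem3p19:
  fixes X :: "'a set" and d :: "'a \<Rightarrow> 'a \<Rightarrow> ennreal"
  assumes "lawvere_metric X d"
  shows "(\<forall>U. openin (c_scott_topology X d) U \<longrightarrow> openin (generalized_scott_topology X d) U) \<and>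
         (\<forall>U. openin (d_scott_topology X d) U \<longrightarrow> openin (c_scott_topology X d) U)"
proof (intro conjI allI impI)
  fix U assume U: "openin (c_scott_topology X d) U"
  then have "closedin (c_scott_topology X d) (X - U)" and "U \<subseteq> X"
    using openin_closedin_eq[of "c_scott_topology X d" U] by simp_all
  then obtain \<phi> where \<phi>: "scott_weight X d \<phi>" "X - U = {x\<in>X. \<phi> x = 0}"
    by (auto simp: closedin_c_scott)
  with \<open>U \<subseteq> X\<close> have "U = {x\<in>X. \<phi> x \<noteq> 0}" by blast
  with \<phi>(1) show "openin (generalized_scott_topology X d) U"
    by (simp add: openin_generalized_scott generalized_scott_open_scott_weight)
next
  fix U assume "openin (d_scott_topology X d) U"
  then obtain V where V: "scott_closed (formal_balls X) (ball_le d) (formal_balls X - V)"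
    "U = (\<lambda>x. (x, 0)) -` V \<inter> X"
    by (auto simp: d_scott_topology_def openin_pullback_topology openin_scott)
  \<comment> \<open>The closed set \<open>X - U\<close> is the trace on \<open>X\<close> of the
    Scott closed complement of \<open>V\<close>.\<close>
  have "X - U = {x\<in>X. ball_weight (formal_balls X - V) x = 0}"
    using V(2) ball_weight_eq_0_iff[OF assms V(1)] by (auto simp: formal_balls_def)
  then have "closedin (c_scott_topology X d) (X - U)"
    using scott_weight_ball_weight[OF assms V(1)] by (auto simp: closedin_c_scott)
  moreover have "U \<subseteq> X" using V(2) by blast
  ultimately show "openin (c_scott_topology X d) U"
    by (simp add: openin_closedin_eq)
qed

end
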